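(* Let $L$ be an MV-algebra and let $d:L\to L$ be a map such that $d(L)\subseteq B(L)$. Then the following statements are equivalent: (1) $d$ is an additive derivation on $L$; (2) $d(x)=d(1)\odot x$ for all $x\in L$; (3) $d(x\odot y)=d(x)\odot y=x\odot d(y)$ for all $x,y\in L$.
   Context: An MV-algebra is an algebra $(L,\oplus,{}^\ast,0)$ of type $(2,1,0)$ such that $(L,\oplus,0)$ is a commutative monoid, $(x^\ast)^\ast=x$, $0^\ast\oplus x=0^\ast$, and $(x^\ast\oplus y)^\ast\oplus y=(y^\ast\oplus x)^\ast\oplus x$ for all $x,y\in L$. Put $1=0^\ast$ and $x\odot y=(x^\ast\oplus y^\ast)^\ast$. The Boolean center is $B(L)=\{a\in L\mid a\oplus a=a\}=\{a\in L\mid a\odot a=a\}$. A derivation on $L$ is a map $d:L\to L$ with $d(x\odot y)=(d(x)\odot y)\oplus(x\odot d(y))$ for all $x,y\in L$. It is additive if $d(x\oplus y)=d(x)\oplus d(y)$ for all $x,y\in L$. *)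

theory Defs
  imports Main
begin

class mv_algebra = zero +
  fixes oplus :: "'a \<Rightarrow> 'a \<Rightarrow> 'a"  (infixl "\<oplus>" 65)
    and star :: "'a \<Rightarrow> 'a"  ("_\<^sup>\<star>" [1000] 1000)
  assumes oplus_assoc: "(x \<oplus> y) \<oplus> z = x \<oplus> (y \<oplus> z)"
    and oplus_commute: "x \<oplus> y = y \<oplus> x"
    and oplus_zero: "x \<oplus> 0 = x"
    and star_star: "(x\<^sup>\<star>)\<^sup>\<star> = x"
    and star_zero_oplus: "0\<^sup>\<star> \<oplus> x = 0\<^sup>\<star>"
    and lukasiewicz: "(x\<^sup>\<star> \<oplus> y)\<^sup>\<star> \<oplus> y = (y\<^sup>\<star> \<oplus> x)\<^sup>\<star> \<oplus> x"

definition mv_one :: "'a::mv_algebra"  ("\<one>")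
  where "\<one> = 0\<^sup>\<star>"

definition odot :: "'a::mv_algebra \<Rightarrow> 'a \<Rightarrow> 'a"  (infixl "\<odot>" 70)
  where "x \<odot> y = (x\<^sup>\<star> \<oplus> y\<^sup>\<star>)\<^sup>\<star>"

definition boolean_center :: "'a::mv_algebra set"
  where "boolean_center = {a. a \<oplus> a = a}"

definition derivation :: "('a::mv_algebra \<Rightarrow> 'a) \<Rightarrow> bool"
  where "derivation d \<longleftrightarrow> (\<forall>x y. d (x \<odot> y) = (d x \<odot> y) \<oplus> (x \<odot> d y))"

definition additive :: "('a::mv_algebra \<Rightarrow> 'a) \<Rightarrow> bool"
  where "additive d \<longleftrightarrow> (\<forall>x y. d (x \<oplus> y) = d x \<oplus> d y)"

end

theory Submission
  imports Defs
begin

text \<open>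
  For a Boolean element \<open>a\<close> one has \<open>a \<odot> x = a \<and> x\<close>, and by residuation the map \<open>x \<mapsto> a \<odot> x\<close>
  is additive. Conversely, an additive derivation satisfies \<open>d 1 \<odot> x \<le> d x\<close> (expand
  \<open>d (1 \<odot> x)\<close>), \<open>d x \<le> x\<close> (expand \<open>d (x \<odot> x\<^sup>\<star>) = 0\<close>) and \<open>d x \<le> d 1\<close> (expand
  \<open>d (x \<oplus> x\<^sup>\<star>) = d 1\<close>), so that \<open>d x = d 1 \<and> x = d 1 \<odot> x\<close> as \<open>d 1\<close> is Boolean.
\<close>

lemma oplus_left_commute: "x \<oplus> (y \<oplus> z) = y \<oplus> (x \<oplus> z)" for x :: "'a::mv_algebra"
  by (metis oplus_assoc oplus_commute)

lemmas oplus_ac = oplus_assoc oplus_commute oplus_left_commute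

lemma zero_oplus: "0 \<oplus> x = x" for x :: "'a::mv_algebra"
  by (metis oplus_commute oplus_zero)

lemma one_oplus: "\<one> \<oplus> x = \<one>"
  by (simp add: mv_one_def star_zero_oplus)

lemma oplus_one: "x \<oplus> \<one> = \<one>"
  by (metis one_oplus oplus_commute)

lemma star_one: "\<one>\<^sup>\<star> = 0"
  by (simp add: mv_one_def star_star)

text \<open>With \<open>\<one>\<close> as its first argument, \<open>lukasiewicz\<close> has the
  required sum on the left, and its right side ends in the absorbing summand
  \<open>\<one>\<close>.\<close>

lemma star_oplus_self: "x\<^sup>\<star> \<oplus> x = \<one>" for x :: "'a::mv_algebra"
  using lukasiewicz[of "\<one>" x] by (simp add: star_one zero_oplus oplus_one)

lemma odot_commute: "x \<odot> y = y \<odot> x"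
  by (simp add: odot_def oplus_commute)

lemma odot_assoc: "(x \<odot> y) \<odot> z = x \<odot> (y \<odot> z)"
  by (simp add: odot_def star_star oplus_assoc)

lemma odot_left_commute: "x \<odot> (y \<odot> z) = y \<odot> (x \<odot> z)"
  by (metis odot_assoc odot_commute)

lemmas odot_ac = odot_assoc odot_commute odot_left_commute

lemma one_odot: "\<one> \<odot> x = x"
  by (simp add: odot_def star_one zero_oplus star_star)

lemma odot_zero: "x \<odot> 0 = 0"
  using oplus_one[of "x\<^sup>\<star>"] by (simp add: odot_def mv_one_def star_star)

lemma odot_star_self: "x \<odot> x\<^sup>\<star> = 0"
  by (metis odot_def odot_commute star_oplus_self star_one star_star)

text \<open>The natural order of an MV-algebra: the Lukasiewicz implication
  \<open>x\<^sup>\<star> \<oplus> y\<close> takes the value \<open>\<one>\<close>.\<close>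

definition mv_le :: "'a::mv_algebra \<Rightarrow> 'a \<Rightarrow> bool"  (infix "\<preceq>" 50)
  where "x \<preceq> y \<longleftrightarrow> x\<^sup>\<star> \<oplus> y = \<one>"

lemma mv_le_refl: "x \<preceq> x"
  by (simp add: mv_le_def star_oplus_self)

text \<open>Both sides of \<open>lukasiewicz\<close> express the join of \<open>x\<close> and
  \<open>y\<close>; one hypothesis collapses the left side to \<open>y\<close>, the other the right
  side to \<open>x\<close>.\<close>

lemma mv_le_antisym: "x \<preceq> y \<Longrightarrow> y \<preceq> x \<Longrightarrow> x = y"
  unfolding mv_le_def using lukasiewicz[of x y] by (simp add: star_one zero_oplus)

lemma mv_le_oplus: "x \<preceq> x \<oplus> y"
  by (simp add: mv_le_def oplus_assoc[symmetric] star_oplus_self one_oplus)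

text \<open>The witness is \<open>(y\<^sup>\<star> \<oplus> x)\<^sup>\<star>\<close>, the difference
  of \<open>y\<close> and \<open>x\<close>: adding \<open>x\<close> gives their join, which is
  \<open>y\<close>.\<close>

lemma mv_le_obtain_oplus:
  assumes "x \<preceq> y"
  obtains z where "y = x \<oplus> z"
  using assms lukasiewicz[of x y]
  by (metis mv_le_def oplus_commute star_one zero_oplus)

lemma mv_le_trans: "x \<preceq> y \<Longrightarrow> y \<preceq> z \<Longrightarrow> x \<preceq> z"
  by (metis mv_le_obtain_oplus mv_le_oplus oplus_assoc)

lemma oplus_mono: "x \<preceq> y \<Longrightarrow> u \<preceq> v \<Longrightarrow> x \<oplus> u \<preceq> y \<oplus> v"
  by (elim mv_le_obtain_oplus) (metis mv_le_oplus oplus_assoc oplus_left_commute)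

text \<open>Residuation: both inequalities unfold to the same sum of \<open>a\<^sup>\<star>\<close>,
  \<open>x\<^sup>\<star>\<close> and \<open>y\<close> being \<open>\<one>\<close>.\<close>

lemma odot_le_iff: "a \<odot> x \<preceq> y \<longleftrightarrow> x \<preceq> a\<^sup>\<star> \<oplus> y"
  by (simp add: mv_le_def odot_def star_star oplus_ac)

lemma odot_le: "a \<odot> x \<preceq> a"
  by (metis odot_le_iff mv_le_oplus star_oplus_self oplus_one mv_le_def)

lemma odot_mono: "x \<preceq> y \<Longrightarrow> a \<odot> x \<preceq> a \<odot> y"
  by (metis odot_le_iff mv_le_refl mv_le_trans)

text \<open>This passes from idempotence under \<open>\<oplus>\<close> to idempotence under
  \<open>\<odot>\<close>, and later merges two copies of \<open>a\<^sup>\<star>\<close>.\<close>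

lemma star_boolean:
  assumes "a \<in> boolean_center"
  shows "a\<^sup>\<star> \<in> boolean_center"
proof -
  have aa: "a \<oplus> a = a"
    using assms by (simp add: boolean_center_def)
  \<comment> \<open>The other side of \<open>lukasiewicz\<close> is
    \<open>(a \<oplus> a)\<^sup>\<star> \<oplus> a\<close>, which idempotence reduces to
    \<open>a\<^sup>\<star> \<oplus> a\<close>.\<close>
  have "(a\<^sup>\<star> \<oplus> a\<^sup>\<star>)\<^sup>\<star> \<oplus> a\<^sup>\<star> = \<one>"
    using lukasiewicz[of a "a\<^sup>\<star>"]
    by (simp add: star_star aa star_oplus_self)
  then have "a\<^sup>\<star> \<oplus> a\<^sup>\<star> \<preceq> a\<^sup>\<star>"
    by (simp add: mv_le_def)
  then show ?thesis
    by (simp add: boolean_center_def mv_le_antisym mv_le_oplus)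
qed

lemma boolean_odot_self: "a \<in> boolean_center \<Longrightarrow> a \<odot> a = a"
  using star_boolean[of a] by (simp add: odot_def boolean_center_def star_star)

text \<open>Together with \<open>odot_le\<close> and commutativity, this makes
  \<open>a \<odot> x\<close> the meet of \<open>a\<close> and \<open>x\<close>.\<close>

lemma boolean_le_odot:
  assumes "a \<in> boolean_center" "z \<preceq> a" "z \<preceq> x"
  shows "z \<preceq> a \<odot> x"
proof -
  \<comment> \<open>The right side is the meet of \<open>a\<close> and \<open>z\<close>, obtained by
    dualising the join in \<open>lukasiewicz\<close> through \<open>\<^sup>\<star>\<close>.\<close>
  have "z = a \<odot> (a\<^sup>\<star> \<oplus> z)"
    using \<open>z \<preceq> a\<close> lukasiewicz[of "z\<^sup>\<star>" "a\<^sup>\<star>"]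
    by (metis mv_le_def odot_def oplus_commute star_one star_star zero_oplus)
  \<comment> \<open>multiply by \<open>a\<close> once more and absorb it using \<open>a \<odot> a = a\<close>\<close>
  then have "z = a \<odot> z"
    by (metis assms(1) boolean_odot_self odot_assoc)
  then show ?thesis
    using odot_mono[OF \<open>z \<preceq> x\<close>] by metis
qed

lemma boolean_odot_oplus:
  assumes "a \<in> boolean_center"
  shows "a \<odot> (x \<oplus> y) = (a \<odot> x) \<oplus> (a \<odot> y)"
proof (rule mv_le_antisym)
  \<comment> \<open>Residuation bounds each summand; the two resulting copies of
    \<open>a\<^sup>\<star>\<close> then merge into one, because \<open>a\<^sup>\<star>\<close> is
    Boolean.\<close>
  have "x \<oplus> y \<preceq> (a\<^sup>\<star> \<oplus> a \<odot> x) \<oplus> (a\<^sup>\<star> \<oplus> a \<odot> y)"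
    by (intro oplus_mono) (simp_all add: mv_le_refl flip: odot_le_iff)
  also have "\<dots> = (a\<^sup>\<star> \<oplus> a\<^sup>\<star>) \<oplus> (a \<odot> x \<oplus> a \<odot> y)"
    by (simp add: oplus_ac)
  finally show "a \<odot> (x \<oplus> y) \<preceq> a \<odot> x \<oplus> a \<odot> y"
    using star_boolean[OF assms] by (simp add: odot_le_iff boolean_center_def)
next
  have "a \<odot> x \<oplus> a \<odot> y \<preceq> a"
    using oplus_mono[OF odot_le odot_le, of a x a y] assms by (simp add: boolean_center_def)
  moreover have "a \<odot> x \<oplus> a \<odot> y \<preceq> x \<oplus> y"
    by (intro oplus_mono) (metis odot_commute odot_le)+
  ultimately show "a \<odot> x \<oplus> a \<odot> y \<preceq> a \<odot> (x \<oplus> y)"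
    by (rule boolean_le_odot[OF assms])
qed

lemma derivation_zero:
  assumes "derivation d"
  shows "d 0 = 0"
proof -
  have "d (0 \<odot> 0) = (d 0 \<odot> 0) \<oplus> (0 \<odot> d 0)"
    using assms unfolding derivation_def by blast
  then show ?thesis
    by (metis odot_commute odot_zero zero_oplus)
qed

lemma derivation_le:
  assumes "derivation d"
  shows "d x \<preceq> x"
proof -
  have "d (x \<odot> x\<^sup>\<star>) = (d x \<odot> x\<^sup>\<star>) \<oplus> (x \<odot> d (x\<^sup>\<star>))"
    using assms unfolding derivation_def by blast
  then have "d x \<odot> x\<^sup>\<star> \<preceq> 0"
    by (metis derivation_zero[OF assms] mv_le_oplus odot_star_self)
  \<comment> \<open>In this order of factors, residuation moves \<open>x\<^sup>\<star>\<close>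
    across and yields the bound \<open>x\<^sup>\<star>\<^sup>\<star> \<oplus> 0\<close>, that is
    \<open>x\<close>.\<close>
  then have "x\<^sup>\<star> \<odot> d x \<preceq> 0"
    by (simp add: odot_commute)
  then show ?thesis
    by (simp add: odot_le_iff star_star oplus_zero)
qed

lemma derivation_ge:
  assumes "derivation d"
  shows "d \<one> \<odot> x \<preceq> d x"
proof -
  have "d (\<one> \<odot> x) = (d \<one> \<odot> x) \<oplus> (\<one> \<odot> d x)"
    using assms unfolding derivation_def by blast
  then show ?thesis
    by (metis mv_le_oplus one_odot)
qed

lemma additive_le_one:
  assumes "additive d"
  shows "d x \<preceq> d \<one>"
  using assms unfolding additive_def by (metis mv_le_oplus oplus_commute star_oplus_self)

theorem theorem3p14:
  fixes d :: "'a::mv_algebra \<Rightarrow> 'a"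
  assumes "range d \<subseteq> boolean_center"
  shows "((derivation d \<and> additive d) \<longleftrightarrow> (\<forall>x. d x = d \<one> \<odot> x))
       \<and> ((\<forall>x. d x = d \<one> \<odot> x) \<longleftrightarrow> (\<forall>x y. d (x \<odot> y) = d x \<odot> y \<and> d x \<odot> y = x \<odot> d y))"
proof (intro conjI iffI)
  have bool: "d x \<in> boolean_center" for x
    using assms by blast
  show "\<forall>x. d x = d \<one> \<odot> x" if "derivation d \<and> additive d"
    using that bool
    by (blast intro: mv_le_antisym boolean_le_odot derivation_le derivation_ge additive_le_one)
  show "derivation d" if *: "\<forall>x. d x = d \<one> \<odot> x"
    unfolding derivation_def
  proof (intro allI)
    fix x y
    \<comment> \<open>Both Leibniz terms equal the same Boolean element, so their sum is that
      element again.\<close>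
    have "d x \<odot> y = d (x \<odot> y)" "x \<odot> d y = d (x \<odot> y)"
      using * by (metis odot_assoc, metis odot_left_commute)
    then show "d (x \<odot> y) = (d x \<odot> y) \<oplus> (x \<odot> d y)"
      using bool[of "x \<odot> y"] by (simp add: boolean_center_def)
  qed
  show "additive d" if "\<forall>x. d x = d \<one> \<odot> x"
    unfolding additive_def using that boolean_odot_oplus[OF bool] by metis
  show "\<forall>x y. d (x \<odot> y) = d x \<odot> y \<and> d x \<odot> y = x \<odot> d y" if "\<forall>x. d x = d \<one> \<odot> x"
    using that by (metis odot_assoc odot_left_commute)
  \<comment> \<open>Take \<open>\<one>\<close> as the first factor of the product.\<close>
  show "\<forall>x. d x = d \<one> \<odot> x" if "\<forall>x y. d (x \<odot> y) = d x \<odot> y \<and> d x \<odot> y = x \<odot> d y"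
    using that by (metis one_odot)
qed

end
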